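(* Let $G$ be a graph obtained from a simple cubic graph by replacing some of its edges with paths of length at least five (each replaced edge $uv$ is deleted and replaced by a path from $u$ to $v$ with at least five edges whose internal vertices are new; the lengths may differ for different edges). Then $\operatorname{lir}(^2G)\leq 2$.
   Context: All graphs are finite and without loops. A cubic graph is a 3-regular graph. The length of a path is its number of edges. A multigraph $M$ consists of a nonempty finite vertex set and a multiset of edges (2-element subsets of the vertex set); the degree of a vertex is the sum of the multiplicities of the edges incident to it. For a simple graph $G$, $^2G$ denotes the 2-multigraph obtained from $G$ by replacing each edge of $G$ with two parallel edges. A multigraph is locally irregular if every two adjacent vertices have different degrees. An edge coloring of a multigraph $M$ assigns a color to each element of the edge multiset (it need not be proper, and parallel edges may receive different colors); it is locally irregular if, for each color, the submultigraph of $M$ induced by the edges of that color is locally irregular. The locally irregular chromatic index $\operatorname{lir}(M)$ is the smallest number of colors in a locally irregular edge coloring of $M$, if one exists; so $\operatorname{lir}(M)\leq k$ means that $M$ has a locally irregular edge coloring using at most $k$ colors. *)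

theory Defs
  imports Main "HOL-Library.Multiset" "HOL-Library.Extended_Nat" "HOL-Library.Disjoint_Sets"
begin

record 'a sgraph =
  sverts :: "'a set"
  sedges :: "'a set set"

record 'a multigraph =
  mverts :: "'a set"
  medges :: "'a set multiset"

definition simple_graph :: "'a sgraph \<Rightarrow> bool" where
  "simple_graph G \<longleftrightarrow>
     finite (sverts G) \<and> sverts G \<noteq> {} \<and> (\<forall>e \<in> sedges G. e \<subseteq> sverts G \<and> card e = 2)"

definition sdegree :: "'a sgraph \<Rightarrow> 'a \<Rightarrow> nat" where
  "sdegree G v = card {e \<in> sedges G. v \<in> e}"

definition cubic :: "'a sgraph \<Rightarrow> bool" where
  "cubic G \<longleftrightarrow> (\<forall>v \<in> sverts G. sdegree G v = 3)"

definition is_multigraph :: "'a multigraph \<Rightarrow> bool" where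
  "is_multigraph M \<longleftrightarrow>
     finite (mverts M) \<and> mverts M \<noteq> {} \<and> (\<forall>e \<in># medges M. e \<subseteq> mverts M \<and> card e = 2)"

definition mdegree :: "'a multigraph \<Rightarrow> 'a \<Rightarrow> nat" where
  "mdegree M v = (\<Sum>e | e \<in># medges M \<and> v \<in> e. count (medges M) e)"

definition locally_irregular :: "'a multigraph \<Rightarrow> bool" where
  "locally_irregular M \<longleftrightarrow> (\<forall>u v. {u, v} \<in># medges M \<longrightarrow> mdegree M u \<noteq> mdegree M v)"

definition double_graph :: "'a sgraph \<Rightarrow> 'a multigraph" where
  "double_graph G = \<lparr>mverts = sverts G, medges = repeat_mset 2 (mset_set (sedges G))\<rparr>"

text \<open>
  The elements of the edge multiset: the pairs \<open>(e, j)\<close> with \<open>j\<close> below the multiplicity of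
  \<open>e\<close> are the distinct parallel copies of \<open>e\<close>. An edge coloring is a function on these pairs,
  so parallel edges may receive different colors.
\<close>

definition edge_elements :: "'a multigraph \<Rightarrow> ('a set \<times> nat) set" where
  "edge_elements M = (SIGMA e : set_mset (medges M). {..<count (medges M) e})"

definition color_class :: "'a multigraph \<Rightarrow> ('a set \<times> nat \<Rightarrow> 'c) \<Rightarrow> 'c \<Rightarrow> 'a set multiset" where
  "color_class M c i = image_mset fst (mset_set {x \<in> edge_elements M. c x = i})"

definition induced_submultigraph :: "'a set multiset \<Rightarrow> 'a multigraph" where
  "induced_submultigraph A = \<lparr>mverts = \<Union>(set_mset A), medges = A\<rparr>"

definition locally_irregular_coloring :: "'a multigraph \<Rightarrow> ('a set \<times> nat \<Rightarrow> 'c) \<Rightarrow> bool" where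
  "locally_irregular_coloring M c \<longleftrightarrow>
     (\<forall>i \<in> c ` edge_elements M. locally_irregular (induced_submultigraph (color_class M c i)))"

text \<open>The value is \<open>\<infinity>\<close> if no locally irregular edge coloring exists.\<close>

definition lir :: "'a multigraph \<Rightarrow> enat" where
  "lir M = Inf {enat (card (c ` edge_elements M)) | c :: 'a set \<times> nat \<Rightarrow> nat.
                 locally_irregular_coloring M c}"

text \<open>Paths are given by their lists of vertices.\<close>

definition path_edges :: "'a list \<Rightarrow> 'a set set" where
  "path_edges p = {{p ! i, p ! Suc i} | i. Suc i < length p}"

definition path_length :: "'a list \<Rightarrow> nat" where
  "path_length p = length p - 1"

definition internal_vertices :: "'a list \<Rightarrow> 'a set" where
  "internal_vertices p = set (butlast (tl p))"

text \<open>
  \<open>G\<close> arises from \<open>H\<close> by replacing each edge \<open>e\<close> in some set \<open>F\<close> of edges (possibly empty,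
  possibly all of them) with a path \<open>P e\<close> of length at least \<open>n\<close>.
\<close>

definition edges_replaced_by_paths :: "nat \<Rightarrow> 'a sgraph \<Rightarrow> 'a sgraph \<Rightarrow> bool" where
  "edges_replaced_by_paths n H G \<longleftrightarrow>
     (\<exists>F P. F \<subseteq> sedges H \<and>
        (\<forall>e \<in> F. P e \<noteq> [] \<and> distinct (P e) \<and> {hd (P e), last (P e)} = e \<and>
           path_length (P e) \<ge> n \<and> internal_vertices (P e) \<inter> sverts H = {}) \<and>
        disjoint_family_on (\<lambda>e. internal_vertices (P e)) F \<and>
        G = \<lparr>sverts = sverts H \<union> (\<Union>e\<in>F. internal_vertices (P e)),
             sedges = (sedges H - F) \<union> (\<Union>e\<in>F. path_edges (P e))\<rparr>)"

lemma finite_sedges: "simple_graph G \<Longrightarrow> finite (sedges G)"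
  by (rule finite_subset[of _ "Pow (sverts G)"]) (auto simp: simple_graph_def)

lemma is_multigraph_double_graph: "simple_graph G \<Longrightarrow> is_multigraph (double_graph G)"
  using finite_sedges[of G]
  by (auto simp: is_multigraph_def double_graph_def simple_graph_def numeral_2_eq_2)

lemma finite_edge_elements: "finite (edge_elements M)"
  by (simp add: edge_elements_def)

lemma count_color_class:
  "count (color_class M c i) e = card {j. j < count (medges M) e \<and> c (e, j) = i}"
proof -
  let ?A = "{x \<in> edge_elements M. c x = i}"
  have fin: "finite ?A"
    by (simp add: finite_edge_elements)
  have "count (color_class M c i) e = card {x \<in> ?A. fst x = e}"
    using fin by (simp add: color_class_def count_image_mset' sum.If_cases flip: card_eq_sum)
      (metis (mono_tags, lifting))
  also have "{x \<in> ?A. fst x = e} = Pair e ` {j. j < count (medges M) e \<and> c (e, j) = i}"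
    by (auto simp: edge_elements_def intro: count_inI)
  also have "card \<dots> = card {j. j < count (medges M) e \<and> c (e, j) = i}"
    by (simp add: card_image inj_on_def)
  finally show ?thesis .
qed

lemma lir_le_iff:
  "lir M \<le> enat k \<longleftrightarrow>
     (\<exists>c :: 'a set \<times> nat \<Rightarrow> nat. locally_irregular_coloring M c \<and> card (c ` edge_elements M) \<le> k)"
  for M :: "'a multigraph"
proof
  let ?S = "{enat (card (c ` edge_elements M)) | c :: 'a set \<times> nat \<Rightarrow> nat.
               locally_irregular_coloring M c}"
  assume le: "lir M \<le> enat k"
  then have "?S \<noteq> {}"
    unfolding lir_def by (metis Inf_enat_def enat_ord_simps(5) infinity_ileE)
  then have "Inf ?S \<in> ?S"
    by (metis (no_types, lifting) Inf_enat_def LeastI ex_in_conv)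
  with le show "\<exists>c :: 'a set \<times> nat \<Rightarrow> nat.
      locally_irregular_coloring M c \<and> card (c ` edge_elements M) \<le> k"
    unfolding lir_def by auto
next
  assume "\<exists>c :: 'a set \<times> nat \<Rightarrow> nat.
      locally_irregular_coloring M c \<and> card (c ` edge_elements M) \<le> k"
  then obtain c :: "'a set \<times> nat \<Rightarrow> nat"
    where "locally_irregular_coloring M c" "card (c ` edge_elements M) \<le> k" by blast
  then show "lir M \<le> enat k"
    unfolding lir_def by (intro Inf_lower2[of "enat (card (c ` edge_elements M))"]) auto
qed

lemma simple_graph_edges_replaced_by_paths:
  assumes H: "simple_graph H" and R: "edges_replaced_by_paths n H G"
  shows "simple_graph G"
proof -
  obtain F P where F: "F \<subseteq> sedges H"
    and P: "\<And>e. e \<in> F \<Longrightarrow> P e \<noteq> [] \<and> distinct (P e) \<and> {hd (P e), last (P e)} = e"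
    and G: "G = \<lparr>sverts = sverts H \<union> (\<Union>e\<in>F. internal_vertices (P e)),
                 sedges = (sedges H - F) \<union> (\<Union>e\<in>F. path_edges (P e))\<rparr>"
    using R unfolding edges_replaced_by_paths_def by blast
  have finF: "finite F"
    using F finite_sedges[OF H] by (rule finite_subset)
  have sub: "set (P e) \<subseteq> sverts G" if eF: "e \<in> F" for e
  proof
    fix x assume x: "x \<in> set (P e)"
    have hl: "hd (P e) \<in> sverts H" "last (P e) \<in> sverts H"
      using P[OF eF] F eF H by (auto simp: simple_graph_def)
    obtain a q where aq: "P e = a # q"
      using P[OF eF] by (cases "P e") auto
    show "x \<in> sverts G"
    proof (cases "q = []")
      case True
      then show ?thesis using x hl aq G by auto
    next
      case False
      then have "set q = insert (last q) (set (butlast q))"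
        by (metis append_butlast_last_id insert_is_Un list.simps(15) rotate1.simps(2) set_rotate1)
      moreover have "internal_vertices (P e) = set (butlast q)"
        using aq by (simp add: internal_vertices_def)
      then have "set (butlast q) \<subseteq> sverts G"
        using G eF by auto
      ultimately show ?thesis
        using x hl aq G False by auto
    qed
  qed
  have "e \<subseteq> sverts G \<and> card e = 2" if e: "e \<in> sedges G" for e
  proof (cases "e \<in> sedges H")
    case True
    then show ?thesis using H G by (auto simp: simple_graph_def)
  next
    case False
    then obtain f i where f: "f \<in> F" and i: "Suc i < length (P f)"
      and ei: "e = {P f ! i, P f ! Suc i}"
      using e G by (auto simp: path_edges_def)
    have "P f ! i \<noteq> P f ! Suc i"
      using P[OF f] i by (simp add: nth_eq_iff_index_eq)
    then show ?thesis
      using sub[OF f] i ei by (auto simp: card_2_iff)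
  qed
  then show ?thesis
    using H G finF by (auto simp: simple_graph_def internal_vertices_def)
qed

end

theory Submission
  imports Defs
begin

text \<open>
  A colouring of the doubled graph with two colours amounts to a red multiplicity in \<open>{0, 1, 2}\<close> for
  every edge. On a cubic graph the red and blue degrees of a vertex add up to \<open>6\<close>, so it suffices that
  adjacent vertices have different red degrees (the 1-2-3 theorem for cubic graphs). For \<open>K\<^sub>4\<close> such
  weights are written down; any other connected cubic graph has a proper 3-colouring by Brooks'
  theorem, and an odd closed walk allows prescribing all vertex sums modulo 3, in particular as the
  colours. A bipartite graph has instead sums \<open>0\<close> on one side and nonzero sums on the other.

  When an edge of weight \<open>a\<close> is replaced by a path, its first and last edges get the weight \<open>a\<close>, so
  red degrees in the cubic graph do not change. Adjacent inner vertices of the path have different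
  degrees iff the weights at distance two along the path differ, which decouples the weights in odd
  and even positions. The second and the penultimate weight must avoid some values dictated by the
  two end vertices; as these have different red degrees, the two weights can be chosen distinct, and
  this is all that is needed from length five on.
\<close>

section \<open>Brooks' theorem for cubic graphs\<close>

text \<open>The codomain is general because integer weights serve for signed corrections and natural
  numbers for multiplicities; with red multiplicities as \<open>f\<close> this is the red
  degree.\<close>

definition incident_sum :: "'a set set \<Rightarrow> ('a set \<Rightarrow> 'b::comm_monoid_add) \<Rightarrow> 'a \<Rightarrow> 'b" where
  "incident_sum E f v = (\<Sum>e | e \<in> E \<and> v \<in> e. f e)"

text \<open>Connectedness means that no proper nonempty vertex set is closed under adjacency. A
  failure of it directly provides the two parts into which \<open>cubic_weights_exist\<close> splits
  a graph.\<close>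

locale connected_cubic =
  fixes V :: "'a set" and E :: "'a set set"
  assumes finite_V: "finite V"
    and edge: "e \<in> E \<Longrightarrow> e \<subseteq> V \<and> card e = 2"
    and degree: "v \<in> V \<Longrightarrow> card {e \<in> E. v \<in> e} = 3"
    and connected: "\<lbrakk>X \<subseteq> V; X \<noteq> {}; \<And>x y. \<lbrakk>x \<in> X; {x, y} \<in> E\<rbrakk> \<Longrightarrow> y \<in> X\<rbrakk> \<Longrightarrow> X = V"
begin

section \<open>Neighbourhoods in a connected cubic graph\<close>

definition N :: "'a \<Rightarrow> 'a set" where
  "N v = {u. {v, u} \<in> E}"

lemma N_sym: "u \<in> N v \<longleftrightarrow> v \<in> N u"
  by (simp add: N_def insert_commute)

lemma N_irrefl: "v \<notin> N v"
  using edge[of "{v}"] by (auto simp: N_def)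

lemma N_V: "u \<in> N v \<Longrightarrow> u \<in> V \<and> v \<in> V"
  using edge[of "{v, u}"] by (auto simp: N_def)

lemma finite_E: "finite E"
  by (rule finite_subset[of _ "Pow V"]) (use edge finite_V in auto)

lemma finite_N: "finite (N v)"
  by (rule finite_subset[of _ V]) (use N_V finite_V in auto)

lemma bij_N: "bij_betw (\<lambda>u. {v, u}) (N v) {e \<in> E. v \<in> e}"
proof (intro bij_betwI')
  fix e assume e: "e \<in> {e \<in> E. v \<in> e}"
  then obtain a b where "e = {a, b}" using edge by (metis (no_types, lifting) card_2_iff mem_Collect_eq)
  with e show "\<exists>u\<in>N v. e = {v, u}"
    by (auto simp: N_def insert_commute)
qed (auto simp: N_def doubleton_eq_iff)

lemma card_N: "v \<in> V \<Longrightarrow> card (N v) = 3"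
  using bij_betw_same_card[OF bij_N] degree by metis

lemma incident_sum_N: "incident_sum E f v = (\<Sum>u\<in>N v. f {v, u})"
  unfolding incident_sum_def using sum.reindex_bij_betw[OF bij_N, of f v] by simp

lemma N_closed_eq_V: "\<lbrakk>X \<subseteq> V; X \<noteq> {}; \<And>x. x \<in> X \<Longrightarrow> N x \<subseteq> X\<rbrakk> \<Longrightarrow> X = V"
  by (rule connected) (auto simp: N_def)

section \<open>Greedy 3-colouring\<close>

definition proper3 :: "'a set \<Rightarrow> ('a \<Rightarrow> nat) \<Rightarrow> bool" where
  "proper3 U c \<longleftrightarrow> (\<forall>u\<in>U. c u < 3 \<and> (\<forall>v\<in>U \<inter> N u. c u \<noteq> c v))"

text \<open>The hypothesis bounds the number of colours seen, not of coloured neighbours, because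
  the root of a tree may have three coloured neighbours, two of which share a colour.\<close>

lemma proper3_extend:
  assumes "proper3 U c" "v \<notin> U" "card (c ` (N v \<inter> U)) \<le> 2"
  shows "\<exists>k. proper3 (insert v U) (c(v := k))"
proof -
  have "card (c ` (N v \<inter> U)) < card {..<3::nat}"
    using assms(3) by simp
  then have "\<not> {..<3} \<subseteq> c ` (N v \<inter> U)"
    using card_mono[of "c ` (N v \<inter> U)" "{..<3}"] finite_N[of v] by auto
  then obtain k where k: "k < 3" "k \<notin> c ` (N v \<inter> U)" by auto
  let ?c = "c(v := k)"
  have "?c u < 3 \<and> ?c u \<noteq> ?c w" if "u \<in> insert v U" "w \<in> insert v U" "w \<in> N u" for u w
  proof -
    have "u \<noteq> w" "u \<in> N w" using that N_irrefl N_sym by auto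
    moreover have "k \<noteq> c x" if "x \<in> U" "x \<in> N v" for x using k that by auto
    ultimately show ?thesis
      using that assms(1,2) k(1) unfolding proper3_def by (metis Int_iff fun_upd_apply insertE)
  qed
  moreover have "?c u < 3" if "u \<in> insert v U" for u
    using that assms(1) k(1) by (auto simp: proper3_def)
  ultimately have "proper3 (insert v U) ?c" unfolding proper3_def by blast
  then show ?thesis ..
qed

text \<open>By connectedness some vertex of a nonempty proper subset has a neighbour outside. It is
  coloured last and then sees at most two coloured neighbours.\<close>

lemma proper3_exists:
  assumes "U \<subset> V"
  shows "\<exists>c. proper3 U c"
  using assms
proof (induction "card U" arbitrary: U)
  case 0
  then have "U = {}"
    using finite_V finite_subset by (metis card_0_eq psubset_imp_subset)
  then show ?case by (simp add: proper3_def)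
next
  case (Suc n)
  then have "U \<noteq> {}" by auto
  then obtain u y where uy: "u \<in> U" "y \<in> N u" "y \<notin> U"
    using N_closed_eq_V[of U] Suc.prems by blast
  have "finite U" using Suc.prems finite_V finite_subset by blast
  then have "n = card (U - {u})" using Suc(2) uy by simp
  with Suc.hyps(1)[of "U - {u}"] Suc.prems obtain c where c: "proper3 (U - {u}) c" by blast
  have "card (c ` (N u \<inter> (U - {u}))) \<le> card (N u \<inter> (U - {u}))"
    by (simp add: card_image_le finite_N)
  also have "\<dots> \<le> card (N u - {y})"
    by (rule card_mono) (use uy finite_N in auto)
  also have "\<dots> = 2"
    using uy card_N[of u] N_V[of y u] by (simp add: finite_N)
  finally have "\<exists>k. proper3 (insert u (U - {u})) (c(u := k))"
    by (intro proper3_extend[OF c]) auto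
  then show ?case using uy by (auto simp: insert_absorb)
qed

text \<open>\<open>W\<close> spans a tree with root \<open>x\<close> that grows by one leaf at a
  time. Undoing the steps is the order of colouring in which each vertex except \<open>x\<close>
  comes before its parent.\<close>

inductive tree_at :: "'a \<Rightarrow> 'a set \<Rightarrow> bool" for x where
  tree_root: "tree_at x {x}"
| tree_step: "\<lbrakk>tree_at x W; u \<notin> W; w \<in> W; w \<in> N u\<rbrakk> \<Longrightarrow> tree_at x (insert u W)"

text \<open>The path is added vertex by vertex; vertices already in the tree are skipped, so it may
  meet \<open>W\<close> again.\<close>

lemma tree_at_path:
  "\<lbrakk>tree_at x W; w \<in> W; successively (\<lambda>u v. v \<in> N u) (w # p)\<rbrakk> \<Longrightarrow> tree_at x (W \<union> set p)"
proof (induction p arbitrary: w W)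
  case (Cons u p)
  then have "w \<in> N u" using N_sym by auto
  then have "tree_at x (insert u W)"
    using Cons.prems tree_step by (cases "u \<in> W") (auto simp: insert_absorb)
  then show ?case using Cons.IH[of "insert u W" u] Cons.prems by auto
qed auto

text \<open>Colouring the tree from the leaves towards the root, every vertex but the root still has
  an uncoloured neighbour when its turn comes.\<close>

lemma greedy_tree:
  assumes "tree_at x W" "proper3 U c" "U \<inter> W = {}"
    and "y \<in> N x \<inter> U" "z \<in> N x \<inter> U" "y \<noteq> z" "c y = c z"
  shows "\<exists>c. proper3 (U \<union> W) c"
  using assms
proof (induction arbitrary: U c)
  case tree_root
  \<comment> \<open>The colour of \<open>y\<close> is still represented by \<open>z\<close>, so
    leaving out \<open>y\<close> loses no colour.\<close>
  have "c ` (N x \<inter> U) \<subseteq> c ` (N x - {y})"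
    using tree_root by (auto simp: image_iff)
  then have "card (c ` (N x \<inter> U)) \<le> card (c ` (N x - {y}))"
    by (simp add: card_mono finite_N)
  also have "\<dots> \<le> card (N x - {y})"
    by (simp add: card_image_le finite_N)
  also have "\<dots> = 2"
    using tree_root card_N[of x] N_V[of y x] by (simp add: finite_N)
  finally have "\<exists>k. proper3 (insert x U) (c(x := k))"
    using tree_root(2) by (intro proper3_extend[OF tree_root(1)]) auto
  then show ?case by auto
next
  case (tree_step W u w)
  have "card (c ` (N u \<inter> U)) \<le> card (N u \<inter> U)"
    by (simp add: card_image_le finite_N)
  also have "\<dots> \<le> card (N u - {w})"
    by (rule card_mono) (use tree_step finite_N in auto)
  also have "\<dots> = 2"
    using tree_step card_N[of u] N_V[of w u] by (simp add: finite_N)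
  finally obtain k where k: "proper3 (insert u U) (c(u := k))"
    using proper3_extend[OF tree_step.prems(1)] tree_step.prems(2) by blast
  have "\<exists>c. proper3 (insert u U \<union> W) c"
    by (rule tree_step.IH[OF k]) (use tree_step in auto)
  then show ?case by simp
qed

section \<open>Paths and cycles as vertex lists\<close>

abbreviation walk_list :: "'a list \<Rightarrow> bool" where
  "walk_list \<equiv> successively (\<lambda>u v. v \<in> N u)"

lemma walk_list_rev: "walk_list p \<Longrightarrow> walk_list (rev p)"
  by (simp add: successively_rev N_sym)

lemma cycle_rotate:
  assumes "walk_list (xs @ ys)" "hd (xs @ ys) \<in> N (last (xs @ ys))"
  shows "walk_list (ys @ xs) \<and> hd (ys @ xs) \<in> N (last (ys @ xs))"
  using assms by (cases "xs = []"; cases "ys = []") (simp_all add: successively_append_iff)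

text \<open>All neighbours of the last vertex of a longest path lie on the path. Cutting the path
  off before the first of them leaves a cycle that contains them all.\<close>

lemma exists_cycle:
  assumes "V \<noteq> {}"
  obtains p where "walk_list p" "distinct p" "p \<noteq> []" "hd p \<in> N (last p)"
    "set p \<subseteq> V" "N (last p) \<subseteq> set p"
proof -
  let ?P = "\<lambda>p. walk_list p \<and> distinct p \<and> set p \<subseteq> V \<and> p \<noteq> []"
  obtain x where x: "x \<in> V" using assms by blast
  have ex: "?P [x]" using x by auto
  have bound: "\<forall>p. ?P p \<longrightarrow> length p < Suc (card V)"
    using finite_V by (metis card_mono distinct_card le_imp_less_Suc)
  obtain p where p: "?P p" and max: "\<And>q. ?P q \<Longrightarrow> length q \<le> length p"
    using ex_has_greatest_nat[of ?P, OF ex bound] by blast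
  let ?w = "last p"
  have w: "?w \<in> V" using p last_in_set by blast
  have sub: "N ?w \<subseteq> set p"
  proof
    fix y assume y: "y \<in> N ?w"
    show "y \<in> set p"
    proof (rule ccontr)
      assume "y \<notin> set p"
      then have "?P (p @ [y])" using p y N_V[OF y] by (simp add: successively_append_iff)
      from max[OF this] show False by simp
    qed
  qed
  have "N ?w \<noteq> {}" using card_N[OF w] by auto
  then have "\<exists>y\<in>set p. y \<in> N ?w" using sub by auto
  then obtain ys y zs where s: "p = ys @ y # zs" "y \<in> N ?w" "\<forall>z\<in>set ys. z \<notin> N ?w"
    using split_list_first_prop[of p "\<lambda>y. y \<in> N ?w"] by blast
  have l: "last (y # zs) = ?w" using s by simp
  show thesis
  proof (rule that[of "y # zs"])
    have "walk_list (ys @ y # zs)" using p unfolding s(1) by blast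
    then show "walk_list (y # zs)" unfolding successively_append_iff by blast
    have "set p = set ys \<union> set (y # zs)" using s(1) by simp
    then show "N (last (y # zs)) \<subseteq> set (y # zs)" unfolding l using sub s(3) by blast
    show "hd (y # zs) \<in> N (last (y # zs))" unfolding l using s(2) by simp
    show "distinct (y # zs)" "set (y # zs) \<subseteq> V" using p unfolding s(1) by auto
  qed simp
qed

text \<open>Some consecutive vertices \<open>x\<close>, \<open>y\<close>, \<open>z\<close> of the
  cycle have \<open>x\<close> and \<open>z\<close> nonadjacent. These two get the same colour, and
  the remaining vertices form a tree with root \<open>y\<close>, which is coloured greedily.\<close>

lemma hamiltonian_proper3:
  assumes p: "walk_list p" "distinct p" "hd p \<in> N (last p)" "set p = V" and card: "card V \<noteq> 4" "V \<noteq> {}"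
  shows "\<exists>c. proper3 V c"
proof -
  obtain v where v: "v \<in> V" using card by auto
  then have "card (insert v (N v)) = 4" using card_N N_irrefl finite_N by (subst card_insert_disjoint) auto
  then have "4 \<le> card V" using v N_V by (metis card_mono finite_V insert_subset subsetI)
  \<comment> \<open>A vertex and its neighbours make up four vertices, and exactly four are
    excluded.\<close>
  with card have "5 \<le> length p" using p by (metis Suc_leI distinct_card le_neq_implies_less eval_nat_numeral(3) numeral_nat(2))
  then obtain a b c d e r where r: "p = a # b # c # d # e # r"
    by (auto simp: Suc_le_length_iff eval_nat_numeral)
  have sub: "{a, b, d, e} \<subseteq> N c" if "a \<in> N c" "b \<in> N d" "c \<in> N e"
    using that p(1) N_sym unfolding r by auto
  \<comment> \<open>Otherwise \<open>c\<close> would have the four neighbours \<open>a\<close>,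
    \<open>b\<close>, \<open>d\<close>, \<open>e\<close>.\<close>
  have "\<not> (a \<in> N c \<and> b \<in> N d \<and> c \<in> N e)"
  proof
    assume "a \<in> N c \<and> b \<in> N d \<and> c \<in> N e"
    then have "card {a, b, d, e} \<le> card (N c)" using sub finite_N by (simp add: card_mono)
    then show False using card_N[of c] p unfolding r by auto
  qed
  moreover have "walk_list ((b # c # d # e # r) @ [a])" "walk_list ((c # d # e # r) @ [a, b])"
    using cycle_rotate[of "[a]" "b # c # d # e # r"] cycle_rotate[of "[a, b]" "c # d # e # r"] p(1,3)
    unfolding r by simp_all
  \<comment> \<open>The cycle is rotated so that a nonadjacent pair at distance two along it comes
    first.\<close>
  ultimately consider "walk_list (a # b # c # d # e # r)" "a \<notin> N c"
    | "walk_list (b # c # d # e # r @ [a])" "b \<notin> N d"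
    | "walk_list (c # d # e # r @ [a, b])" "c \<notin> N e"
    using p(1) unfolding r append_Cons by blast
  then have "\<exists>x y z q. walk_list (x # y # z # q) \<and> distinct (x # y # z # q) \<and>
     set (x # y # z # q) = V \<and> x \<notin> N z"
  proof cases
    case 1
    then show ?thesis using p(2,4) unfolding r by blast
  next
    case 2
    moreover have "distinct (b # c # d # e # r @ [a])" "set (b # c # d # e # r @ [a]) = V"
      using p(2,4) unfolding r by auto
    ultimately show ?thesis by blast
  next
    case 3
    moreover have "distinct (c # d # e # r @ [a, b])" "set (c # d # e # r @ [a, b]) = V"
      using p(2,4) unfolding r by auto
    ultimately show ?thesis by blast
  qed
  then obtain x y z q where q: "walk_list (x # y # z # q)" "distinct (x # y # z # q)"
     "set (x # y # z # q) = V" "x \<notin> N z" by blast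
  have yV: "y \<in> V" using q by auto
  \<comment> \<open>The third neighbour of \<open>y\<close> connects the root to the rest of the
    cycle.\<close>
  have "\<not> N y \<subseteq> {x, z}"
    using card_mono[of "{x, z}" "N y"] card_N[OF yV] card_insert_le_m1[of 2 "{z}" x] by auto
  then obtain w where w: "w \<in> N y" "w \<in> set q"
    using q(3) N_irrefl[of y] N_V[of _ y] by auto
  then obtain q1 q2 where s: "q = q1 @ w # q2" by (meson split_list)
  \<comment> \<open>From \<open>w\<close> the tree follows \<open>q\<close> forwards to its end and
    backwards to its start.\<close>
  have "tree_at y ({y} \<union> set [w])"
    by (rule tree_at_path[OF tree_root]) (use w in auto)
  then have "tree_at y (({y} \<union> set [w]) \<union> set q2)"
    by (rule tree_at_path[where w = w]) (use q s in \<open>auto simp: successively_append_iff successively_Cons\<close>)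
  moreover have "walk_list (q1 @ [w])" using q s
    by (auto simp: successively_append_iff successively_Cons)
  then have "walk_list (w # rev q1)"
    using walk_list_rev by fastforce
  ultimately have "tree_at y ((({y} \<union> set [w]) \<union> set q2) \<union> set (rev q1))"
    by (intro tree_at_path[where w = w and W = "({y} \<union> set [w]) \<union> set q2"]) auto
  then have T: "tree_at y (insert y (set q))" using s by (simp add: Un_commute insert_commute)
  have "\<exists>c. proper3 ({x, z} \<union> insert y (set q)) c"
  proof (rule greedy_tree[OF T, where c = "\<lambda>_. 0" and y = x and z = z])
    show "proper3 {x, z} (\<lambda>_. 0)"
      using q(4) N_sym[of x z] N_irrefl by (auto simp: proper3_def)
    show "x \<in> N y \<inter> {x, z}" "z \<in> N y \<inter> {x, z}" using q(1) N_sym[of x y] by auto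
  qed (use q in auto)
  moreover have "{x, z} \<union> insert y (set q) = V" using q by auto
  ultimately show ?thesis by simp
qed

text \<open>If some vertex of the cycle has a neighbour outside, then so does a vertex \<open>a\<close> whose successor
  \<open>b\<close> has none. The rest of the graph is coloured first, \<open>b\<close> may copy the colour of an outer
  neighbour of \<open>a\<close>, and the path \<open>p - b\<close> ending in \<open>a\<close> is coloured greedily.\<close>

lemma brooks_cubic:
  assumes "card V \<noteq> 4" "V \<noteq> {}"
  shows "\<exists>c. proper3 V c"
proof -
  obtain p where p: "walk_list p" "distinct p" "p \<noteq> []" "hd p \<in> N (last p)"
    "set p \<subseteq> V" "N (last p) \<subseteq> set p"
    using exists_cycle[OF assms(2)] by blast
  show ?thesis
  proof (cases "set p = V")
    case True
    then show ?thesis using hamiltonian_proper3 p assms by blast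
  next
    case False
    then have "\<exists>a\<in>set p. \<not> N a \<subseteq> set p" using N_closed_eq_V[of "set p"] p by auto
    then obtain ys a zs where s: "p = ys @ a # zs" "\<not> N a \<subseteq> set p" "\<forall>z\<in>set zs. N z \<subseteq> set p"
      using split_list_last_prop[of p "\<lambda>a. \<not> N a \<subseteq> set p"] by blast
    \<comment> \<open>The last vertex of \<open>p\<close> has all its neighbours on
      \<open>p\<close>, so \<open>a\<close> is not the last one and has a successor.\<close>
    then have "zs \<noteq> []" using p by auto
    then obtain b zs' where zs: "zs = b # zs'" by (cases zs) auto
    obtain u where u: "u \<in> N a" "u \<notin> set p" using s by blast
    have "walk_list ((b # zs') @ (ys @ [a]))"
      using cycle_rotate[of "ys @ [a]" "b # zs'"] p(1,4) unfolding s(1) zs by simp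
    then have "walk_list (zs' @ ys @ [a])"
      by (auto simp: successively_Cons)
    then have "walk_list (a # rev (zs' @ ys))"
      using walk_list_rev[of "zs' @ ys @ [a]"] by simp
    then have T: "tree_at a ({a} \<union> set (rev (zs' @ ys)))"
      by (rule tree_at_path[OF tree_root, rotated]) simp
    have "V - set p \<subset> V" using p by (cases p) auto
    then obtain c where c: "proper3 (V - set p) c" using proper3_exists by blast
    let ?c = "c(b := c u)"
    have "\<exists>c. proper3 (insert b (V - set p) \<union> ({a} \<union> set (rev (zs' @ ys)))) c"
    proof (rule greedy_tree[OF T, where c = ?c and y = u and z = b])
      \<comment> \<open>No vertex coloured so far is adjacent to \<open>b\<close>, so
        \<open>b\<close> may take any colour.\<close>
      have "N b \<subseteq> set p" using s zs by auto
      then have "x \<notin> N b" "b \<notin> N x" if "x \<notin> set p" for x using that N_sym by auto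
      then show "proper3 (insert b (V - set p)) ?c"
        using c u N_V[of u a] N_irrefl unfolding proper3_def by auto
      show "u \<in> N a \<inter> insert b (V - set p)" using u N_V by auto
      show "b \<in> N a \<inter> insert b (V - set p)" using p s zs by (auto simp: successively_append_iff)
      show "u \<noteq> b" "?c u = ?c b" using u s zs by auto
    qed (use p s zs in auto)
    moreover have "insert b (V - set p) \<union> ({a} \<union> set (rev (zs' @ ys))) = V"
      using p s zs by auto
    ultimately show ?thesis by simp
  qed
qed

section \<open>Weights with distinct sums at adjacent vertices\<close>

text \<open>Weights are arbitrary integers here, so that corrections are exact; they are reduced
  modulo 3 only in \<open>weights_from_sums\<close>.\<close>

definition attainable :: "('a \<Rightarrow> int) \<Rightarrow> bool" where
  "attainable s \<longleftrightarrow> (\<exists>f. \<forall>v. incident_sum E f v = s v)"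

text \<open>The Boolean is the parity of the number of steps, \<open>True\<close> for odd; a closed
  odd walk witnesses that the graph is not bipartite.\<close>

inductive walk :: "'a \<Rightarrow> 'a \<Rightarrow> bool \<Rightarrow> bool" for u where
  walk_refl: "walk u u False"
| walk_step: "\<lbrakk>walk u v b; w \<in> N v\<rbrakk> \<Longrightarrow> walk u w (\<not> b)"

lemma attainable_edge:
  assumes "attainable s" "w \<in> N v"
  shows "attainable (\<lambda>z. s z + (if z = v then x else 0) + (if z = w then x else 0))"
proof -
  obtain f where f: "\<And>z. incident_sum E f z = s z"
    using assms(1) by (auto simp: attainable_def)
  let ?g = "\<lambda>e. f e + (if e = {v, w} then x else 0)"
  have vw: "v \<noteq> w" "{v, w} \<in> E" using assms(2) N_irrefl by (auto simp: N_def)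
  have "incident_sum E ?g z = s z + (if z \<in> {v, w} then x else 0)" for z
  proof -
    have "(\<Sum>e | e \<in> E \<and> z \<in> e. if e = {v, w} then x else 0) = (if z \<in> {v, w} then x else 0)"
      using vw finite_E by (subst sum.delta) auto
    then show ?thesis using f[of z] by (simp add: incident_sum_def sum.distrib)
  qed
  then have "incident_sum E ?g z = s z + (if z = v then x else 0) + (if z = w then x else 0)" for z
    using vw(1) by simp
  then show ?thesis unfolding attainable_def by blast
qed

text \<open>Alternating \<open>\<plusminus>x\<close> along a walk changes the sums at its two ends only.\<close>

lemma attainable_walk:
  assumes "walk u v b" "attainable s"
  shows "attainable (\<lambda>z. s z + (if z = u then x else 0) + (if z = v then (if b then x else - x) else 0))"
  using assms
proof (induction rule: walk.induct)
  case walk_refl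
  have "(\<lambda>z. s z + (if z = u then x else 0) + (if z = u then (if False then x else - x) else 0)) = s"
    by auto
  with walk_refl show ?case by simp
next
  case (walk_step v b w)
  \<comment> \<open>This weight on the new edge cancels the change at the previous end
    \<open>v\<close>.\<close>
  let ?y = "if b then - x else x"
  have "attainable (\<lambda>z. (s z + (if z = u then x else 0) + (if z = v then (if b then x else - x) else 0))
     + (if z = v then ?y else 0) + (if z = w then ?y else 0))"
    by (rule attainable_edge[OF walk_step.IH]) (use walk_step in auto)
  moreover have "(\<lambda>z. (s z + (if z = u then x else 0) + (if z = v then (if b then x else - x) else 0))
     + (if z = v then ?y else 0) + (if z = w then ?y else 0)) =
     (\<lambda>z. s z + (if z = u then x else 0) + (if z = w then (if \<not> b then x else - x) else 0))"
    by auto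
  ultimately show ?case by simp
qed

lemma walk_in_V: "\<lbrakk>walk u v b; u \<in> V\<rbrakk> \<Longrightarrow> v \<in> V"
  by (induction rule: walk.induct) (use N_V in auto)

lemma walk_connected:
  assumes "u \<in> V" "v \<in> V"
  shows "\<exists>b. walk u v b"
proof -
  have "{v. \<exists>b. walk u v b} = V"
    by (rule N_closed_eq_V) (use assms walk_in_V walk_refl walk_step in blast)+
  then show ?thesis using assms by blast
qed

text \<open>Parities add, and on Booleans \<open>\<noteq>\<close> is addition modulo 2.\<close>

lemma walk_trans: "\<lbrakk>walk v w b; walk u v a\<rbrakk> \<Longrightarrow> walk u w (a \<noteq> b)"
  by (induction rule: walk.induct) (use walk_step in fastforce)+

lemma walk_sym: "walk u v b \<Longrightarrow> walk v u b"
proof (induction rule: walk.induct)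
  case (walk_step v b w)
  have "walk w v True" using walk.walk_step[OF walk.walk_refl, of v w] walk_step(2) N_sym by simp
  from walk_trans[OF walk_step.IH this] show ?case by simp
qed (rule walk_refl)

text \<open>The vertices are corrected one after another: an alternating walk from \<open>v\<close>
  to \<open>r\<close> moves the error at \<open>v\<close> to \<open>r\<close> and leaves all other
  sums alone.\<close>

lemma attainable_except_root:
  assumes "r \<in> V"
  obtains t where "attainable t" "\<And>v. \<lbrakk>v \<in> V; v \<noteq> r\<rbrakk> \<Longrightarrow> t v = s v"
proof -
  have "\<exists>t. attainable t \<and> (\<forall>v\<in>A. t v = s v)" if "finite A" "A \<subseteq> V - {r}" for A
    using that
  proof (induction A)
    case empty
    have "attainable (\<lambda>_. 0)"
      unfolding attainable_def by (rule exI[of _ "\<lambda>_. 0"]) (simp add: incident_sum_def)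
    then show ?case by auto
  next
    case (insert v A)
    then obtain t where t: "attainable t" "\<forall>v\<in>A. t v = s v" by auto
    obtain b where "walk v r b" using walk_connected assms insert.prems by blast
    note attainable_walk[OF this t(1), of "s v - t v"]
    moreover have "v \<noteq> r" "\<forall>z\<in>A. z \<noteq> v \<and> z \<noteq> r" using insert by auto
    ultimately show ?case using t(2) by - (rule exI, rule conjI, assumption, auto)
  qed
  from this[of "V - {r}"] show thesis using finite_V that by auto
qed

text \<open>Alternating \<open>x\<close> along a closed odd walk changes only the sum at
  \<open>r\<close>, by \<open>2 * x\<close>. Twice the missing amount as \<open>x\<close> gives four
  times that amount, which is the same modulo 3.\<close>

lemma mod3_sums_nonbipartite:
  assumes "walk r r True" "r \<in> V"
  obtains t where "attainable t" "\<And>v. v \<in> V \<Longrightarrow> t v mod 3 = s v mod 3"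
proof -
  obtain t where t: "attainable t" "\<And>v. \<lbrakk>v \<in> V; v \<noteq> r\<rbrakk> \<Longrightarrow> t v = s v"
    using attainable_except_root assms(2) by blast
  from attainable_walk[OF assms(1) t(1), of "2 * (s r - t r)"] show thesis
  proof (rule that)
    have "t r + 2 * (s r - t r) + 2 * (s r - t r) = s r + 3 * (s r - t r)"
      by simp
    then have "(t r + 2 * (s r - t r) + 2 * (s r - t r)) mod 3 = s r mod 3"
      by (metis mod_mult_self2)
    then show "(t v + (if v = r then 2 * (s r - t r) else 0) +
          (if v = r then if True then 2 * (s r - t r) else - (2 * (s r - t r)) else 0)) mod 3 =
         s v mod 3" if "v \<in> V" for v
      using t(2)[OF that] by (cases "v = r") (simp_all only: if_True if_False add_0_right simp_thms)
  qed
qed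

text \<open>In the bipartite case the sums are \<open>0\<close> on one side and nonzero modulo 3 on the side of
  the root \<open>r\<close>; a zero sum at \<open>r\<close> is repaired by shifting one unit to another vertex of that side.\<close>

lemma mod3_sums_bipartite:
  assumes "\<not> walk r r True" "r \<in> V"
  obtains t where "attainable t" "\<And>u v. \<lbrakk>u \<in> V; v \<in> N u\<rbrakk> \<Longrightarrow> t u mod 3 \<noteq> t v mod 3"
proof -
  note result = that
  define even_side where "even_side = {v \<in> V. walk r v False}"
  have even_iff: "v \<in> even_side \<longleftrightarrow> u \<notin> even_side" if uv: "u \<in> V" "v \<in> N u" for u v
  proof -
    have "v \<in> V" using N_V uv by blast
    \<comment> \<open>Walks of both parities to the same vertex would combine to a closed odd walk
      at \<open>r\<close>.\<close>
    have excl: "\<not> (walk r x False \<and> walk r x True)" for x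
      using walk_trans[of x r False r True] walk_sym assms(1) by auto
    obtain a where a: "walk r u a" using walk_connected assms(2) uv by blast
    then have "walk r v (\<not> a)" using walk_step uv by blast
    with a show ?thesis using excl[of u] excl[of v] uv \<open>v \<in> V\<close> by (cases a) (auto simp: even_side_def)
  qed
  obtain t where t: "attainable t" "\<And>v. \<lbrakk>v \<in> V; v \<noteq> r\<rbrakk> \<Longrightarrow> t v = (if v \<in> even_side then 1 else 0)"
    using attainable_except_root[OF assms(2), of "\<lambda>v. if v \<in> even_side then 1 else 0"] by blast
  have r: "r \<in> even_side" using assms(2) walk_refl by (simp add: even_side_def)
  have fin: thesis
    if "attainable t'" "\<And>v. v \<in> V \<Longrightarrow> t' v mod 3 = 0 \<longleftrightarrow> v \<notin> even_side" for t'
  proof (rule result[OF that(1)])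
    fix u v assume "u \<in> V" "v \<in> N u"
    then show "t' u mod 3 \<noteq> t' v mod 3"
      using even_iff[of u v] that(2)[of u] that(2)[of v] N_V[of v u] by metis
  qed
  show thesis
  proof (cases "t r mod 3 = 0")
    case False
    show thesis
    proof (rule fin[OF t(1)])
      show "t v mod 3 = 0 \<longleftrightarrow> v \<notin> even_side" if "v \<in> V" for v
        using t(2)[OF that] r False by (cases "v = r") auto
    qed
  next
    case True
    have "N r \<noteq> {}" using card_N[OF assms(2)] by auto
    then obtain y where y: "y \<in> N r" by blast
    then have "y \<in> V" "r \<in> N y" using N_V N_sym by auto
    then have "\<not> N y \<subseteq> {r}" using card_mono[of "{r}" "N y"] card_N[of y] by auto
    then obtain b where b: "b \<in> N y" "b \<noteq> r" by blast
    then have bV: "b \<in> V" using N_V by blast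
    have "walk r y (\<not> False)" by (rule walk_step[OF walk_refl y])
    from walk_step[OF this b(1)] have w: "walk r b False" by simp
    then have be: "b \<in> even_side" using bV by (simp add: even_side_def)
    have rmod: "(t r - 1) mod 3 \<noteq> 0" using True by presburger
    show thesis
    \<comment> \<open>The sum at \<open>r\<close> drops from residue 0 to 2 and the one at
      \<open>b\<close> rises from 1 to 2, so both become nonzero.\<close>
    proof (rule fin[OF attainable_walk[OF w t(1), of "-1"]])
      show "(t v + (if v = r then - 1 else 0) +
           (if v = b then if False then - 1 else - (- 1) else 0)) mod 3 = 0 \<longleftrightarrow> v \<notin> even_side"
        if "v \<in> V" for v
        using t(2)[OF that] b(2) r be rmod by (cases "v = r"; cases "v = b") auto
    qed
  qed
qed

text \<open>Reducing every weight modulo 3 keeps the residues of all sums, and different residues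
  force different sums.\<close>

lemma weights_from_sums:
  assumes "attainable t" "\<And>u v. \<lbrakk>u \<in> V; v \<in> N u\<rbrakk> \<Longrightarrow> t u mod 3 \<noteq> t v mod 3"
  shows "\<exists>f :: 'a set \<Rightarrow> nat. (\<forall>e. f e \<le> 2) \<and>
    (\<forall>u v. {u, v} \<in> E \<longrightarrow> incident_sum E f u \<noteq> incident_sum E f v)"
proof -
  obtain f where f: "\<And>v. incident_sum E f v = t v" using assms(1) by (auto simp: attainable_def)
  let ?g = "\<lambda>e. nat (f e mod 3)"
  have g: "int (incident_sum E ?g v) mod 3 = t v mod 3" for v
    unfolding f[symmetric] incident_sum_def by (simp add: mod_sum_eq)
  have "?g e \<le> 2" for e by (simp add: nat_le_iff)
  moreover have "incident_sum E ?g u \<noteq> incident_sum E ?g v" if "{u, v} \<in> E" for u v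
  proof -
    have "v \<in> N u" using that by (simp add: N_def)
    then have "t u mod 3 \<noteq> t v mod 3" using assms(2) N_V by blast
    then show ?thesis using g[of u] g[of v] by metis
  qed
  ultimately show ?thesis by (intro exI[of _ ?g]) blast
qed

text \<open>On four vertices the graph is complete and has no proper 3-colouring, so four different
  sums are realised explicitly.\<close>

lemma weights_K4:
  assumes "card V = 4"
  shows "\<exists>f :: 'a set \<Rightarrow> nat. (\<forall>e. f e \<le> 2) \<and>
    (\<forall>u v. {u, v} \<in> E \<longrightarrow> incident_sum E f u \<noteq> incident_sum E f v)"
proof -
  obtain xs where xs: "set xs = V" "distinct xs" using finite_distinct_list finite_V by blast
  then have "length xs = 4" using assms distinct_card by fastforce
  then obtain a b c d where "xs = [a, b, c, d]"
    by (auto simp: numeral_eq_Suc length_Suc_conv)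
  then have V: "V = {a, b, c, d}" and dist: "distinct [a, b, c, d]" using xs by auto
  have N: "N v = V - {v}" if "v \<in> V" for v
  proof (rule card_subset_eq)
    show "N v \<subseteq> V - {v}" using N_V N_irrefl by blast
    show "card (N v) = card (V - {v})" using card_N[OF that] that assms finite_V by simp
  qed (use finite_V in auto)
  define f :: "'a set \<Rightarrow> nat" where
    "f e = (if e = {b, c} then 0 else if e = {b, d} then 1 else 2)" for e
  have Ns: "N a = {b, c, d}" "N b = {a, c, d}" "N c = {a, b, d}" "N d = {a, b, c}"
    using N V dist by auto
  have sums: "incident_sum E f a = 6" "incident_sum E f b = 3" "incident_sum E f c = 4" "incident_sum E f d = 5"
    unfolding incident_sum_N Ns using dist by (auto simp: f_def doubleton_eq_iff)
  have "incident_sum E f u \<noteq> incident_sum E f v" if "{u, v} \<in> E" for u v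
  proof -
    have "v \<in> N u" using that by (simp add: N_def)
    then have "u \<in> V" "v \<in> V" "u \<noteq> v" using N_V N_irrefl by blast+
    then show ?thesis unfolding V using sums by auto
  qed
  moreover have "f e \<le> 2" for e by (simp add: f_def)
  ultimately show ?thesis by blast
qed

lemma weights_exist:
  "\<exists>f :: 'a set \<Rightarrow> nat. (\<forall>e. f e \<le> 2) \<and>
    (\<forall>u v. {u, v} \<in> E \<longrightarrow> incident_sum E f u \<noteq> incident_sum E f v)"
proof (cases "card V = 4 \<or> V = {}")
  case True
  then show ?thesis
  proof
    assume "V = {}"
    then have "E = {}" using edge by fastforce
    then show ?thesis by (intro exI[of _ "\<lambda>_. 0"]) simp
  qed (rule weights_K4)
next
  case False
  then obtain r where r: "r \<in> V" by blast
  show ?thesis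
  proof (cases "walk r r True")
    case True
    obtain c where c: "proper3 V c" using brooks_cubic False by blast
    obtain t where t: "attainable t" "\<And>v. v \<in> V \<Longrightarrow> t v mod 3 = int (c v) mod 3"
      \<comment> \<open>The colours themselves are the prescribed residues.\<close>
      using mod3_sums_nonbipartite[OF True r, of "\<lambda>v. int (c v)"] by blast
    show ?thesis
    proof (rule weights_from_sums[OF t(1)])
      fix u v assume uv: "u \<in> V" "v \<in> N u"
      then have "v \<in> V" using N_V by blast
      then have "c u \<noteq> c v" "c u < 3" "c v < 3" using c uv by (auto simp: proper3_def)
      then show "t u mod 3 \<noteq> t v mod 3" using t(2) uv \<open>v \<in> V\<close> by simp
    qed
  next
    case False
    then obtain t where "attainable t" "\<And>u v. \<lbrakk>u \<in> V; v \<in> N u\<rbrakk> \<Longrightarrow> t u mod 3 \<noteq> t v mod 3"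
      using mod3_sums_bipartite[OF False r] by blast
    then show ?thesis by (rule weights_from_sums)
  qed
qed

end

text \<open>Induction on the number of vertices reduces to connected graphs: a proper nonempty
  closed set \<open>X\<close> and its complement span cubic graphs without edges between them, whose
  weights are combined.\<close>

lemma cubic_weights_exist:
  fixes V :: "'a set"
  assumes "finite V" "\<And>e. e \<in> E \<Longrightarrow> e \<subseteq> V \<and> card e = 2" "\<And>v. v \<in> V \<Longrightarrow> card {e \<in> E. v \<in> e} = 3"
  shows "\<exists>f :: 'a set \<Rightarrow> nat. (\<forall>e. f e \<le> 2) \<and>
    (\<forall>u v. {u, v} \<in> E \<longrightarrow> incident_sum E f u \<noteq> incident_sum E f v)"
  using assms
proof (induction "card V" arbitrary: V E rule: less_induct)
  case less
  show ?case
  proof (cases "\<exists>X. X \<subset> V \<and> X \<noteq> {} \<and> (\<forall>x y. x \<in> X \<longrightarrow> {x, y} \<in> E \<longrightarrow> y \<in> X)")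
    case False
    then interpret connected_cubic V E
    proof unfold_locales
      show "X = V" if X: "X \<subseteq> V" "X \<noteq> {}" "\<And>x y. \<lbrakk>x \<in> X; {x, y} \<in> E\<rbrakk> \<Longrightarrow> y \<in> X" for X
      proof (rule ccontr)
        assume "X \<noteq> V"
        then have "X \<subset> V" using X(1) by blast
        moreover have "\<forall>x y. x \<in> X \<longrightarrow> {x, y} \<in> E \<longrightarrow> y \<in> X" using X(3) by simp
        ultimately have "\<exists>X. X \<subset> V \<and> X \<noteq> {} \<and> (\<forall>x y. x \<in> X \<longrightarrow> {x, y} \<in> E \<longrightarrow> y \<in> X)"
          using X(2) by (intro exI[of _ X] conjI)
        with False show False ..
      qed
    qed (use less.prems in simp_all)
    show ?thesis by (rule weights_exist)
  next
    case True
    then obtain X where X: "X \<subset> V" "X \<noteq> {}" and closed: "\<And>x y. \<lbrakk>x \<in> X; {x, y} \<in> E\<rbrakk> \<Longrightarrow> y \<in> X"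
      by blast
    have split: "e \<subseteq> X \<or> e \<subseteq> V - X" if e: "e \<in> E" for e
    proof -
      obtain u v where uv: "e = {u, v}" using less.prems(2)[OF e] by (auto simp: card_2_iff)
      have "{u, v} \<in> E" "{v, u} \<in> E" using e uv by (simp_all add: insert_commute)
      then have "u \<in> X \<longleftrightarrow> v \<in> X" using closed by blast
      then show ?thesis using less.prems(2)[OF e] uv by blast
    qed
    have part: "\<exists>f :: 'a set \<Rightarrow> nat. (\<forall>e. f e \<le> 2) \<and>
      (\<forall>u v. {u, v} \<in> E \<and> {u, v} \<subseteq> Y \<longrightarrow> incident_sum E f u \<noteq> incident_sum E f v)"
      if Y: "Y \<subset> V" "\<And>e. e \<in> E \<Longrightarrow> e \<subseteq> Y \<or> e \<inter> Y = {}" for Y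
    proof -
      let ?E = "{e \<in> E. e \<subseteq> Y}"
      \<comment> \<open>No edge leaves \<open>Y\<close>, so degrees and sums at its vertices are the
        same in the part and in the whole graph.\<close>
      have same: "{e \<in> ?E. v \<in> e} = {e \<in> E. v \<in> e}" if "v \<in> Y" for v
        using Y(2) that by blast
      have "\<exists>f :: 'a set \<Rightarrow> nat. (\<forall>e. f e \<le> 2) \<and>
        (\<forall>u v. {u, v} \<in> ?E \<longrightarrow> incident_sum ?E f u \<noteq> incident_sum ?E f v)"
      proof (rule less.hyps)
        show "card Y < card V" using Y(1) less.prems(1) by (rule psubset_card_mono[rotated])
        show "finite Y" using Y(1) less.prems(1) finite_subset by blast
        show "card {e \<in> ?E. v \<in> e} = 3" if "v \<in> Y" for v
          unfolding same[OF that] using less.prems(3) that Y(1) by blast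
        show "e \<subseteq> Y \<and> card e = 2" if "e \<in> ?E" for e
          using less.prems(2)[of e] that by simp
      qed
      then obtain f :: "'a set \<Rightarrow> nat" where f: "\<And>e. f e \<le> 2"
        "\<And>u v. {u, v} \<in> ?E \<Longrightarrow> incident_sum ?E f u \<noteq> incident_sum ?E f v"
        by blast
      have eq: "incident_sum ?E f v = incident_sum E f v" if "v \<in> Y" for v
        unfolding incident_sum_def same[OF that] ..
      have "incident_sum E f u \<noteq> incident_sum E f v" if "{u, v} \<in> E" "{u, v} \<subseteq> Y" for u v
        using f(2)[of u v] eq[of u] eq[of v] that by simp
      with f(1) show ?thesis by (intro exI[of _ f]) simp
    qed
    have meets: "e \<subseteq> X \<or> e \<inter> X = {}" "e \<subseteq> V - X \<or> e \<inter> (V - X) = {}" if "e \<in> E" for e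
      using split[OF that] by blast+
    obtain f1 :: "'a set \<Rightarrow> nat" where f1: "\<And>e. f1 e \<le> 2"
      "\<And>u v. \<lbrakk>{u, v} \<in> E; {u, v} \<subseteq> X\<rbrakk> \<Longrightarrow> incident_sum E f1 u \<noteq> incident_sum E f1 v"
      using part[OF X(1) meets(1)] by blast
    obtain f2 :: "'a set \<Rightarrow> nat" where f2: "\<And>e. f2 e \<le> 2"
      "\<And>u v. \<lbrakk>{u, v} \<in> E; {u, v} \<subseteq> V - X\<rbrakk> \<Longrightarrow> incident_sum E f2 u \<noteq> incident_sum E f2 v"
      using part[OF _ meets(2)] X by blast
    let ?f = "\<lambda>e. if e \<subseteq> X then f1 e else f2 e"
    have s1: "incident_sum E ?f v = incident_sum E f1 v" if "v \<in> X" for v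
      unfolding incident_sum_def by (rule sum.cong) (use split that in auto)
    have s2: "incident_sum E ?f v = incident_sum E f2 v" if "v \<notin> X" for v
      unfolding incident_sum_def by (rule sum.cong) (use split that in auto)
    have "incident_sum E ?f u \<noteq> incident_sum E ?f v" if uv: "{u, v} \<in> E" for u v
      using split[OF uv]
    proof
      assume "{u, v} \<subseteq> X"
      then show ?thesis using f1(2)[OF uv] s1 by simp
    next
      assume "{u, v} \<subseteq> V - X"
      then show ?thesis using f2(2)[OF uv] s2 by simp
    qed
    moreover have "?f e \<le> 2" for e using f1 f2 by simp
    ultimately show ?thesis by (intro exI[of _ ?f]) blast
  qed
qed

section \<open>Weights on the subdivided graph\<close>

text \<open>Three values allow a next term different from both \<open>p\<close> and
  \<open>q\<close>. Avoiding \<open>q\<close> keeps the hypothesis alive in case a single step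
  remains.\<close>

lemma alternating_chain:
  fixes p q :: nat
  assumes "p \<le> 2" "q \<le> 2" "m \<ge> 1" "m = 1 \<Longrightarrow> p \<noteq> q"
  shows "\<exists>t. t 0 = p \<and> t m = q \<and> (\<forall>i. t i \<le> 2) \<and> (\<forall>i<m. t i \<noteq> t (Suc i))"
  using assms(3,1,4)
proof (induction m arbitrary: p rule: dec_induct)
  case base
  then show ?case using assms(2) by (intro exI[of _ "\<lambda>i. if i = 0 then p else q"]) auto
next
  case (step m)
  have "\<exists>x\<le>2::nat. x \<noteq> p \<and> x \<noteq> q" by presburger
  then obtain x where x: "x \<le> 2" "x \<noteq> p" "x \<noteq> q" by blast
  then obtain t where t: "t 0 = x" "t m = q" "\<And>i. t i \<le> 2" "\<And>i. i < m \<Longrightarrow> t i \<noteq> t (Suc i)"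
    using step.IH[of x] by blast
  have "\<forall>i<Suc m. (case i of 0 \<Rightarrow> p | Suc k \<Rightarrow> t k) \<noteq> t i"
    using t x by (auto split: nat.split)
  then show ?case
    using t step.prems(1) by (intro exI[of _ "\<lambda>i. case i of 0 \<Rightarrow> p | Suc k \<Rightarrow> t k"]) (auto split: nat.split)
qed

text \<open>An edge of red multiplicity \<open>a\<close> joins a vertex of degree 3 and red degree \<open>R\<close> to a vertex of
  degree 2 whose other edge has red multiplicity \<open>b\<close>.\<close>

definition end_compatible :: "nat \<Rightarrow> nat \<Rightarrow> nat \<Rightarrow> bool" where
  "end_compatible R a b \<longleftrightarrow> (a \<ge> 1 \<longrightarrow> R \<noteq> a + b) \<and> (a \<le> 1 \<longrightarrow> R + (2 - a) + (2 - b) \<noteq> 6)"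

text \<open>The red condition excludes only \<open>b = R - a\<close>, and the blue one, the blue
  degree being \<open>6 - R\<close>, only \<open>b = R - a - 2\<close>. For \<open>a = 0\<close> or
  \<open>a = 2\<close> just one condition is active; for \<open>a = 1\<close> both exclude a value
  up to 2 only if \<open>R = 3\<close>.\<close>

lemma two_end_choices:
  assumes "a \<le> 2" "a = 1 \<Longrightarrow> R \<noteq> 3"
  shows "\<exists>x\<le>2. \<exists>y\<le>2. x \<noteq> y \<and> end_compatible R a x \<and> end_compatible R a y"
proof -
  consider "end_compatible R a 0" "end_compatible R a 1"
    | "end_compatible R a 0" "end_compatible R a 2"
    | "end_compatible R a 1" "end_compatible R a 2"
  proof -
    consider "a = 0" | "a = 1" "R \<noteq> 3" | "a = 2" using assms by linarith
    then have "end_compatible R a 0 \<and> end_compatible R a 1 \<or> end_compatible R a 0 \<and> end_compatible R a 2 \<or>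
        end_compatible R a 1 \<and> end_compatible R a 2"
    proof cases
      case 1
      then show ?thesis unfolding end_compatible_def by linarith
    next
      case 2
      then show ?thesis unfolding end_compatible_def by linarith
    next
      case 3
      then show ?thesis unfolding end_compatible_def by linarith
    qed
    then show thesis using that by blast
  qed
  then show ?thesis
  proof cases
    case 1
    then show ?thesis by (intro exI[of _ 0] conjI exI[of _ 1]) simp_all
  next
    case 2
    then show ?thesis by (intro exI[of _ 0] conjI exI[of _ 2]) simp_all
  next
    case 3
    then show ?thesis by (intro exI[of _ 1] conjI exI[of _ 2]) simp_all
  qed
qed

lemma one_end_choice:
  assumes "a \<le> 2"
  shows "\<exists>x\<le>2. end_compatible R a x"
proof (cases "a = 1 \<and> R = 3")
  case True
  then show ?thesis by (intro exI[of _ 1]) (simp add: end_compatible_def)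
qed (use two_end_choices assms in blast)

text \<open>At most one of the two ends has red degree 3, so at least one end has two admissible
  weights, one of which differs from the choice at the other end.\<close>

lemma end_choices:
  assumes "R \<noteq> S" "a \<le> 2"
  shows "\<exists>b\<le>2. \<exists>b'\<le>2. b \<noteq> b' \<and> end_compatible R a b \<and> end_compatible S a b'"
proof (cases "a = 1 \<and> R = 3")
  case False
  then obtain x y where "x \<le> 2" "y \<le> 2" "x \<noteq> y" "end_compatible R a x" "end_compatible R a y"
    using two_end_choices[OF assms(2)] by blast
  moreover obtain b' where "b' \<le> 2" "end_compatible S a b'" using one_end_choice[OF assms(2)] by blast
  ultimately show ?thesis by (cases "x = b'") blast+
next
  case True
  then have "S \<noteq> 3" using assms(1) by simp
  then obtain x y where "x \<le> 2" "y \<le> 2" "x \<noteq> y" "end_compatible S a x" "end_compatible S a y"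
    using two_end_choices[OF assms(2)] by blast
  moreover obtain b where "b \<le> 2" "end_compatible R a b" using one_end_choice[OF assms(2)] by blast
  ultimately show ?thesis by (cases "x = b") blast+
qed

lemma path_weights:
  assumes "L \<ge> 5" "a \<le> 2" "R \<noteq> S"
  shows "\<exists>s. (\<forall>i. s i \<le> 2) \<and> s 0 = a \<and> s (L - 1) = a \<and> end_compatible R a (s 1) \<and>
    end_compatible S a (s (L - 2)) \<and> (\<forall>i. Suc (Suc i) < L \<longrightarrow> s i \<noteq> s (Suc (Suc i)))"
proof -
  obtain b b' where b: "b \<le> 2" "b' \<le> 2" "b \<noteq> b'" "end_compatible R a b" "end_compatible S a b'"
    using end_choices[OF assms(3,2)] by blast
  \<comment> \<open>The weights at even positions form a chain \<open>t\<close> with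
    \<open>?m\<close> steps, those at odd positions a chain \<open>u\<close> with \<open>?n\<close>
    steps. The parity of \<open>L\<close> decides which chain ends at the last edge and which at the
    penultimate one.\<close>
  let ?m = "(L - 1) div 2" and ?n = "(L - 2) div 2"
  have "\<exists>t u. (\<forall>i. t i \<le> 2) \<and> (\<forall>i. u i \<le> 2) \<and> t 0 = a \<and> u 0 = b \<and>
    (if even L then t ?m = b' \<and> u ?n = a else t ?m = a \<and> u ?n = b') \<and>
    (\<forall>i<?m. t i \<noteq> t (Suc i)) \<and> (\<forall>i<?n. u i \<noteq> u (Suc i))"
  proof (cases "even L")
    case True
    then have "L \<ge> 6" using assms(1) by presburger
    then have "2 \<le> ?m" "2 \<le> ?n" by linarith+
    then obtain t u where
      "t 0 = a \<and> t ?m = b' \<and> (\<forall>i. t i \<le> 2) \<and> (\<forall>i<?m. t i \<noteq> t (Suc i))"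
      "u 0 = b \<and> u ?n = a \<and> (\<forall>i. u i \<le> 2) \<and> (\<forall>i<?n. u i \<noteq> u (Suc i))"
      using alternating_chain[of a b' ?m, OF assms(2) b(2)] alternating_chain[of b a ?n, OF b(1) assms(2)]
      by auto
    then show ?thesis using True by (intro exI[of _ t] exI[of _ u]) simp
  next
    case False
    \<comment> \<open>For \<open>L = 5\<close> the odd chain has a single step, which is where
      \<open>b \<noteq> b'\<close> is required.\<close>
    have "2 \<le> ?m" "1 \<le> ?n" using assms(1) by linarith+
    then obtain t u where
      "t 0 = a \<and> t ?m = a \<and> (\<forall>i. t i \<le> 2) \<and> (\<forall>i<?m. t i \<noteq> t (Suc i))"
      "u 0 = b \<and> u ?n = b' \<and> (\<forall>i. u i \<le> 2) \<and> (\<forall>i<?n. u i \<noteq> u (Suc i))"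
      using alternating_chain[of a a ?m, OF assms(2) assms(2)] alternating_chain[of b b' ?n, OF b(1,2)] b(3)
      by auto
    then show ?thesis using False by (intro exI[of _ t] exI[of _ u]) simp
  qed
  then obtain t u where tu: "\<And>i. t i \<le> 2" "\<And>i. u i \<le> 2" "t 0 = a" "u 0 = b"
    "even L \<Longrightarrow> t ?m = b'" "even L \<Longrightarrow> u ?n = a" "odd L \<Longrightarrow> t ?m = a" "odd L \<Longrightarrow> u ?n = b'"
    "\<And>i. i < ?m \<Longrightarrow> t i \<noteq> t (Suc i)" "\<And>i. i < ?n \<Longrightarrow> u i \<noteq> u (Suc i)"
    by (metis (full_types))
  define s where "s i = (if even i then t (i div 2) else u (i div 2))" for i
  have "s i \<noteq> s (Suc (Suc i))" if "Suc (Suc i) < L" for i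
  proof (cases "even i")
    case True
    then have "i div 2 < ?m" using that by (elim evenE) auto
    then show ?thesis using tu(9) True by (simp add: s_def)
  next
    case False
    then have "i div 2 < ?n" using that by (elim oddE) auto
    then show ?thesis using tu(10) False by (simp add: s_def)
  qed
  moreover have "s (L - 1) = a \<and> s (L - 2) = b'"
  proof (cases "even L")
    case True
    then obtain k where "L = 2 * k" by (elim evenE)
    then obtain j where "L = 2 * j + 2" using assms(1) by (intro that[of "k - 1"]) auto
    then show ?thesis using tu(5,6) by (simp add: s_def)
  next
    case False
    then obtain k where "L = 2 * k + 1" by (elim oddE)
    then obtain j where "L = 2 * j + 3" using assms(1) by (intro that[of "k - 1"]) auto
    then show ?thesis using tu(7,8) by (simp add: s_def)
  qed
  moreover have "s i \<le> 2" for i using tu(1,2) by (simp add: s_def)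
  moreover have "s 0 = a" "s 1 = b" using tu(3,4) by (simp_all add: s_def)
  ultimately show ?thesis using b by (intro exI[of _ s]) simp
qed

section \<open>Vertices, edges and incidences of the subdivided graph\<close>

locale subdivided_graph =
  fixes V :: "'a set" and E F :: "'a set set" and P :: "'a set \<Rightarrow> 'a list"
  assumes edge: "e \<in> E \<Longrightarrow> e \<subseteq> V \<and> card e = 2"
    and F_E: "F \<subseteq> E"
    and path: "e \<in> F \<Longrightarrow> P e \<noteq> [] \<and> distinct (P e) \<and> {hd (P e), last (P e)} = e \<and>
      path_length (P e) \<ge> 5 \<and> internal_vertices (P e) \<inter> V = {}"
    and disjoint: "disjoint_family_on (\<lambda>e. internal_vertices (P e)) F"
begin

definition L :: "'a set \<Rightarrow> nat" where "L e = length (P e) - 1"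

definition path_edge :: "'a set \<Rightarrow> nat \<Rightarrow> 'a set" where
  "path_edge e i = {P e ! i, P e ! Suc i}"

definition subdivided :: "'a set set" where
  "subdivided = (E - F) \<union> (\<Union>e\<in>F. path_edges (P e))"

lemma path_edges_eq: "path_edges (P e) = path_edge e ` {..<L e}"
  unfolding path_edges_def path_edge_def L_def by auto

lemma length_P: "e \<in> F \<Longrightarrow> length (P e) = Suc (L e)"
  and L_ge: "e \<in> F \<Longrightarrow> 5 \<le> L e"
  using path[of e] by (auto simp: L_def path_length_def)

lemma ends: "e \<in> F \<Longrightarrow> e = {P e ! 0, P e ! L e}"
  using path[of e] by (metis L_def hd_conv_nth last_conv_nth)

lemma internal_vertices_eq: "internal_vertices (P e) = {P e ! i | i. 0 < i \<and> i < L e}"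
proof -
  have "internal_vertices (P e) = {P e ! Suc j | j. Suc j < L e}"
  proof -
    have "j < length (butlast (tl (P e))) \<longleftrightarrow> Suc j < L e" for j by (auto simp: L_def)
    moreover have "butlast (tl (P e)) ! j = P e ! Suc j" if "Suc j < L e" for j
      using that by (simp add: L_def nth_butlast nth_tl)
    ultimately show ?thesis unfolding internal_vertices_def set_conv_nth by (metis (lifting))
  qed
  also have "\<dots> = {P e ! i | i. 0 < i \<and> i < L e}"
    using gr0_conv_Suc by auto
  finally show ?thesis .
qed

text \<open>Inner vertices avoid \<open>V\<close>, where all ends lie, and different paths have
  disjoint interiors. Position \<open>i\<close> is inner, while \<open>j\<close> may be an
  end.\<close>

lemma nth_eq_iff:
  assumes "e \<in> F" "e' \<in> F" "0 < i" "i < L e" "j \<le> L e'"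
  shows "P e ! i = P e' ! j \<longleftrightarrow> e = e' \<and> i = j"
proof
  assume eq: "P e ! i = P e' ! j"
  have i: "P e ! i \<in> internal_vertices (P e)" using assms internal_vertices_eq by blast
  have "0 < j \<and> j < L e'"
  proof (rule ccontr)
    assume "\<not> ?thesis"
    then have "j = 0 \<or> j = L e'" using assms(5) by linarith
    then have "P e' ! j \<in> V" using ends[OF assms(2)] edge[of e'] F_E assms(2) by blast
    then show False using i eq path[OF assms(1)] by auto
  qed
  then have j: "P e' ! j \<in> internal_vertices (P e')" using internal_vertices_eq by blast
  have "e = e'"
    using i j eq disjoint assms(1,2) unfolding disjoint_family_on_def by (metis disjoint_iff)
  then show "e = e' \<and> i = j"
    using eq assms path[of e] length_P[of e] by (simp add: nth_eq_iff_index_eq)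
qed simp

lemma nth_eq_iff_same:
  assumes "e \<in> F" "i \<le> L e" "j \<le> L e"
  shows "P e ! i = P e ! j \<longleftrightarrow> i = j"
  using assms path[of e] length_P[of e] by (simp add: nth_eq_iff_index_eq)

lemma nth_in_V:
  assumes "e \<in> F" "i \<le> L e"
  shows "P e ! i \<in> V \<longleftrightarrow> i = 0 \<or> i = L e"
proof
  assume V: "P e ! i \<in> V"
  show "i = 0 \<or> i = L e"
  proof (rule ccontr)
    assume "\<not> ?thesis"
    then have "P e ! i \<in> internal_vertices (P e)" using assms internal_vertices_eq by auto
    then show False using V path[OF assms(1)] by blast
  qed
next
  assume "i = 0 \<or> i = L e"
  then show "P e ! i \<in> V" using ends[OF assms(1)] edge[of e] F_E assms(1) by blast
qed

lemma path_edge_in_subdivided: "\<lbrakk>e \<in> F; i < L e\<rbrakk> \<Longrightarrow> path_edge e i \<in> subdivided"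
  unfolding subdivided_def path_edges_eq by blast

text \<open>Every path edge contains an inner vertex, which determines the path; distinctness of the
  vertices on it then determines the position.\<close>

lemma path_edge_inj:
  assumes e: "e \<in> F" "e' \<in> F" "i < L e" "j < L e'" and eq: "path_edge e i = path_edge e' j"
  shows "e = e' \<and> i = j"
proof -
  have mem: "P e ! i \<in> path_edge e' j" "P e ! Suc i \<in> path_edge e' j"
    using eq unfolding path_edge_def by blast+
  have "e = e'"
  proof (cases "i = 0")
    case True
    \<comment> \<open>The first edge starts outside the interior, but its second vertex is
      inner.\<close>
    then have "Suc i < L e" using L_ge[OF e(1)] by simp
    then show ?thesis
      using mem(2) nth_eq_iff[of e e' "Suc i" j] nth_eq_iff[of e e' "Suc i" "Suc j"] e
      unfolding path_edge_def by auto
  next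
    case False
    then show ?thesis
      using mem(1) nth_eq_iff[of e e' i j] nth_eq_iff[of e e' i "Suc j"] e
      unfolding path_edge_def by auto
  qed
  moreover have "i = j \<or> i = Suc j" "Suc i = j \<or> Suc i = Suc j"
    using mem e \<open>e = e'\<close> nth_eq_iff_same[OF e(2), of i] nth_eq_iff_same[OF e(2), of "Suc i"]
    unfolding path_edge_def by auto
  ultimately show ?thesis by linarith
qed

lemma path_edge_notin_E:
  assumes "e \<in> F" "i < L e"
  shows "path_edge e i \<notin> E"
proof
  assume "path_edge e i \<in> E"
  then have "P e ! i \<in> V" "P e ! Suc i \<in> V" using edge unfolding path_edge_def by blast+
  then show False using nth_in_V[of e i] nth_in_V[of e "Suc i"] assms L_ge[of e] by simp
qed

lemma incident_internal:
  assumes e: "e \<in> F" "0 < i" "i < L e"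
  shows "{x \<in> subdivided. P e ! i \<in> x} = {path_edge e (i - 1), path_edge e i}"
proof (intro set_eqI iffI)
  fix x assume x: "x \<in> {x \<in> subdivided. P e ! i \<in> x}"
  have "P e ! i \<notin> V" using nth_in_V[of e i] e by simp
  then have "x \<notin> E" using x edge[of x] by blast
  then obtain e' j where ej: "e' \<in> F" "j < L e'" "x = path_edge e' j"
    using x by (auto simp: subdivided_def path_edges_eq)
  then have "P e ! i = P e' ! j \<or> P e ! i = P e' ! Suc j"
    using x by (auto simp: path_edge_def)
  then have "e = e' \<and> (i = j \<or> i = Suc j)"
    using nth_eq_iff[OF e(1) ej(1) e(2,3)] ej(2) by auto
  then show "x \<in> {path_edge e (i - 1), path_edge e i}" using ej by auto
next
  fix x assume "x \<in> {path_edge e (i - 1), path_edge e i}"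
  then obtain j where j: "x = path_edge e j" "j < L e" "j = i \<or> Suc j = i"
    using e that[of "i - 1"] that[of i] by auto
  then have "x \<in> subdivided" using path_edge_in_subdivided[OF e(1)] by simp
  then show "x \<in> {x \<in> subdivided. P e ! i \<in> x}" using j by (auto simp: path_edge_def)
qed

lemma incident_sum_internal:
  assumes e: "e \<in> F" "0 < i" "i < L e"
  shows "incident_sum subdivided h (P e ! i) = h (path_edge e (i - 1)) + h (path_edge e i)"
proof -
  have "i - 1 < L e" using e(3) by linarith
  then have "path_edge e (i - 1) \<noteq> path_edge e i" using path_edge_inj[of e e "i - 1" i] e by auto
  then show ?thesis unfolding incident_sum_def incident_internal[OF e] by simp
qed

text \<open>For \<open>v\<close> on \<open>e\<close>, this is the edge at \<open>v\<close> that
  takes the place of \<open>e\<close> after subdivision: the first or the last edge of the path,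
  depending on which end \<open>v\<close> is.\<close>

definition edge_at :: "'a \<Rightarrow> 'a set \<Rightarrow> 'a set" where
  "edge_at v e = (if e \<in> F then path_edge e (if v = P e ! 0 then 0 else L e - 1) else e)"

text \<open>A vertex of \<open>V\<close> can only be an end of a path, so each path through it
  contributes exactly one edge and its degree is unchanged.\<close>

lemma bij_edge_at:
  assumes v: "v \<in> V"
  shows "bij_betw (edge_at v) {e \<in> E. v \<in> e} {x \<in> subdivided. v \<in> x}"
proof (rule bij_betwI')
  fix e e' assume e: "e \<in> {e \<in> E. v \<in> e}" "e' \<in> {e \<in> E. v \<in> e}"
  let ?i = "\<lambda>e. if v = P e ! 0 then 0 else L e - 1"
  have lt: "?i e < L e" if "e \<in> F" for e using L_ge[OF that] by auto
  show "edge_at v e = edge_at v e' \<longleftrightarrow> e = e'"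
  proof (cases "e \<in> F"; cases "e' \<in> F")
    assume "e \<in> F" "e' \<in> F"
    then show ?thesis using path_edge_inj lt unfolding edge_at_def by metis
  qed (use e lt path_edge_notin_E[of e "?i e"] path_edge_notin_E[of e' "?i e'"] in
      \<open>auto simp: edge_at_def\<close>)
next
  fix e assume e: "e \<in> {e \<in> E. v \<in> e}"
  show "edge_at v e \<in> {x \<in> subdivided. v \<in> x}"
  proof (cases "e \<in> F")
    case True
    let ?i = "if v = P e ! 0 then 0 else L e - 1"
    have "?i < L e" using L_ge[OF True] by auto
    then have "path_edge e ?i \<in> subdivided" by (rule path_edge_in_subdivided[OF True])
    moreover have "v = P e ! 0 \<or> v = P e ! L e" using e ends[OF True] by blast
    then have "v \<in> path_edge e ?i" using L_ge[OF True] by (auto simp: path_edge_def)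
    ultimately show ?thesis using True by (simp add: edge_at_def)
  qed (use e in \<open>auto simp: edge_at_def subdivided_def\<close>)
next
  fix x assume x: "x \<in> {x \<in> subdivided. v \<in> x}"
  show "\<exists>e\<in>{e \<in> E. v \<in> e}. x = edge_at v e"
  proof (cases "x \<in> E - F")
    case True
    then show ?thesis using x by (auto simp: edge_at_def)
  next
    case False
    then obtain e i where e: "e \<in> F" "i < L e" "x = path_edge e i"
      using x by (auto simp: subdivided_def path_edges_eq)
    then obtain j where j: "v = P e ! j" "j \<le> L e" "j = i \<or> j = Suc i"
      using x by (auto simp: path_edge_def)
    then have "j = 0 \<or> j = L e" using nth_in_V[OF e(1) j(2)] v by simp
    moreover have "v \<in> e" using ends[OF e(1)] j(1) calculation by blast
    moreover have "v = P e ! 0 \<longleftrightarrow> j = 0" using nth_eq_iff_same[OF e(1) j(2)] j(1) by simp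
    ultimately have "v \<in> e" "x = edge_at v e" using e j L_ge[OF e(1)] by (auto simp: edge_at_def)
    then show ?thesis using e(1) F_E by blast
  qed
qed

lemma incident_sum_V:
  assumes "v \<in> V"
  shows "incident_sum subdivided h v = incident_sum E (\<lambda>e. h (edge_at v e)) v"
  unfolding incident_sum_def using sum.reindex_bij_betw[OF bij_edge_at[OF assms], of h] by simp

text \<open>Path edges are not in \<open>E\<close> and differ for different pairs of path and
  position, so all these values can be prescribed independently.\<close>

lemma glue_weights:
  fixes f :: "'a set \<Rightarrow> nat"
  shows "\<exists>g. (\<forall>e\<in>E. g e = f e) \<and> (\<forall>e\<in>F. \<forall>i<L e. g (path_edge e i) = s e i)"
proof -
  let ?h = "\<lambda>(e, i). path_edge e i" and ?A = "SIGMA e:F. {..<L e}"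
  have inj: "inj_on ?h ?A" using path_edge_inj by (auto simp: inj_on_def)
  let ?g = "\<lambda>x. if x \<in> E then f x else (case inv_into ?A ?h x of (e, i) \<Rightarrow> s e i)"
  have "?g (path_edge e i) = s e i" if "e \<in> F" "i < L e" for e i
    using path_edge_notin_E[OF that] inv_into_f_f[OF inj, of "(e, i)"] that by simp
  then show ?thesis by (intro exI[of _ ?g]) simp
qed

text \<open>With \<open>g\<close> as red and \<open>2 - g\<close> as blue multiplicity, an edge has
  a red copy iff \<open>g \<ge> 1\<close> and a blue copy iff \<open>g \<le> 1\<close>; this is the
  origin of the two guards.\<close>

lemma subdivided_weights:
  fixes f :: "'a set \<Rightarrow> nat"
  assumes deg: "\<And>v. v \<in> V \<Longrightarrow> card {e \<in> E. v \<in> e} = 3"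
    and f: "\<And>e. f e \<le> 2"
    and fdist: "\<And>u v. {u, v} \<in> E \<Longrightarrow> incident_sum E f u \<noteq> incident_sum E f v"
  shows "\<exists>g :: 'a set \<Rightarrow> nat. (\<forall>x\<in>subdivided. g x \<le> 2) \<and> (\<forall>u v. {u, v} \<in> subdivided \<longrightarrow>
    (g {u, v} \<ge> 1 \<longrightarrow> incident_sum subdivided g u \<noteq> incident_sum subdivided g v) \<and>
    (g {u, v} \<le> 1 \<longrightarrow> incident_sum subdivided (\<lambda>x. 2 - g x) u \<noteq> incident_sum subdivided (\<lambda>x. 2 - g x) v))"
proof -
  let ?r = "incident_sum E f"
  define ok where "ok e s \<longleftrightarrow> (\<forall>i. s i \<le> 2) \<and> s 0 = f e \<and> s (L e - 1) = f e \<and>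
    end_compatible (?r (P e ! 0)) (f e) (s 1) \<and> end_compatible (?r (P e ! L e)) (f e) (s (L e - 2)) \<and>
    (\<forall>i. Suc (Suc i) < L e \<longrightarrow> s i \<noteq> s (Suc (Suc i)))" for e and s :: "nat \<Rightarrow> nat"
  have "\<exists>s. ok e s" if e: "e \<in> F" for e
    unfolding ok_def
  proof (rule path_weights[OF L_ge[OF e] f])
    show "?r (P e ! 0) \<noteq> ?r (P e ! L e)"
      by (rule fdist) (use ends[OF e] e F_E in auto)
  qed
  then obtain s where s: "\<And>e. e \<in> F \<Longrightarrow> ok e (s e)" by metis
  obtain g where gE: "\<And>e. e \<in> E \<Longrightarrow> g e = f e"
    and gP: "\<And>e i. \<lbrakk>e \<in> F; i < L e\<rbrakk> \<Longrightarrow> g (path_edge e i) = s e i"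
    using glue_weights[of f s] by blast
  let ?R = "incident_sum subdivided g" and ?B = "incident_sum subdivided (\<lambda>x. 2 - g x)"
  have g_at: "g (edge_at v e) = f e" if "e \<in> E" for v e
    using that gE gP[of e 0] gP[of e "L e - 1"] s[of e] L_ge[of e]
    by (auto simp: edge_at_def ok_def)
  have R_V: "?R v = ?r v" if "v \<in> V" for v
    unfolding incident_sum_V[OF that] unfolding incident_sum_def by (rule sum.cong) (auto simp: g_at)
  \<comment> \<open>Three doubled edges meet at \<open>v\<close>, so different red degrees in
    \<open>V\<close> also mean different blue degrees.\<close>
  have B_V: "?B v + ?r v = 6" if "v \<in> V" for v
  proof -
    have "?B v = incident_sum E (\<lambda>e. 2 - f e) v"
      unfolding incident_sum_V[OF that] unfolding incident_sum_def by (rule sum.cong) (auto simp: g_at)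
    also have "\<dots> + ?r v = (\<Sum>e | e \<in> E \<and> v \<in> e. 2)"
      unfolding incident_sum_def sum.distrib[symmetric] by (rule sum.cong) (use f in auto)
    finally show ?thesis using deg[OF that] by simp
  qed
  have good_E: "?R u \<noteq> ?R v \<and> ?B u \<noteq> ?B v" if uv: "{u, v} \<in> E" for u v
  proof -
    have "u \<in> V" "v \<in> V" using edge[OF uv] by auto
    then show ?thesis using fdist[OF uv] R_V[of u] R_V[of v] B_V[of u] B_V[of v] by simp
  qed
  have good_P: "(s e i \<ge> 1 \<longrightarrow> ?R (P e ! i) \<noteq> ?R (P e ! Suc i)) \<and> (s e i \<le> 1 \<longrightarrow> ?B (P e ! i) \<noteq> ?B (P e ! Suc i))"
    if e: "e \<in> F" and i: "i < L e" for e i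
  proof -
    have oke: "\<And>j. s e j \<le> 2" "s e 0 = f e" "s e (L e - 1) = f e"
      "end_compatible (?r (P e ! 0)) (f e) (s e 1)" "end_compatible (?r (P e ! L e)) (f e) (s e (L e - 2))"
      "\<And>j. Suc (Suc j) < L e \<Longrightarrow> s e j \<noteq> s e (Suc (Suc j))"
      using s[OF e] unfolding ok_def by blast+
    have R_int: "?R (P e ! j) = s e (j - 1) + s e j"
      and B_int: "?B (P e ! j) = (2 - s e (j - 1)) + (2 - s e j)" if "0 < j" "j < L e" for j
    proof -
      have "j - 1 < L e" using that(2) by linarith
      then show "?R (P e ! j) = s e (j - 1) + s e j" "?B (P e ! j) = (2 - s e (j - 1)) + (2 - s e j)"
        using gP[OF e that(2)] gP[OF e, of "j - 1"] by (simp_all add: incident_sum_internal[OF e that])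
    qed
    have L: "5 \<le> L e" by (rule L_ge[OF e])
    have V: "P e ! 0 \<in> V" "P e ! L e \<in> V" using nth_in_V[OF e] by auto
    consider "i = 0" | "Suc i = L e" | "0 < i" "Suc i < L e" using i by linarith
    then show ?thesis
    proof cases
      case 1
      have "?R (P e ! 1) = f e + s e 1" "?B (P e ! 1) = (2 - f e) + (2 - s e 1)"
        using R_int[of 1] B_int[of 1] L oke(2) by auto
      then show ?thesis
        using 1 oke(2,4) R_V[OF V(1)] B_V[OF V(1)] unfolding end_compatible_def by auto
    next
      case 2
      have i': "i = L e - 1" "i - 1 = L e - 2" using 2 by auto
      have "?R (P e ! i) = s e (L e - 2) + f e" "?B (P e ! i) = (2 - s e (L e - 2)) + (2 - f e)"
        using R_int[of i] B_int[of i] L oke(3) 2 i i' by auto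
      moreover have "P e ! Suc i = P e ! L e" "s e i = f e" using 2 i' oke(3) by auto
      ultimately show ?thesis
        using oke(5) R_V[OF V(2)] B_V[OF V(2)] unfolding end_compatible_def by auto
    next
      case 3
      \<comment> \<open>The weight \<open>s e i\<close> counts at both ends and cancels; the weights
        on either side of it are at distance two.\<close>
      have ne: "s e (i - 1) \<noteq> s e (Suc i)" using oke(6)[of "i - 1"] 3 by auto
      then have "2 - s e (i - 1) \<noteq> 2 - s e (Suc i)" using oke(1)[of "i - 1"] oke(1)[of "Suc i"] by linarith
      moreover have "?R (P e ! Suc i) = s e i + s e (Suc i)" "?B (P e ! Suc i) = (2 - s e i) + (2 - s e (Suc i))"
        using R_int[of "Suc i"] B_int[of "Suc i"] 3(2) unfolding diff_Suc_1 by blast+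
      ultimately show ?thesis using R_int[OF 3(1) i] B_int[OF 3(1) i] ne by linarith
    qed
  qed
  show ?thesis
  proof (intro exI[of _ g] conjI ballI allI impI)
    fix x assume "x \<in> subdivided"
    then show "g x \<le> 2"
      using gE f gP s by (auto simp: subdivided_def path_edges_eq ok_def)
  next
    fix u v assume uv: "{u, v} \<in> subdivided"
    have "(g {u, v} \<ge> 1 \<longrightarrow> ?R u \<noteq> ?R v) \<and> (g {u, v} \<le> 1 \<longrightarrow> ?B u \<noteq> ?B v)"
    proof (cases "{u, v} \<in> E")
      case True
      then show ?thesis using good_E by blast
    next
      case False
      then obtain e i where e: "e \<in> F" "i < L e" "{u, v} = path_edge e i"
        using uv by (auto simp: subdivided_def path_edges_eq)
      then have "u = P e ! i \<and> v = P e ! Suc i \<or> v = P e ! i \<and> u = P e ! Suc i"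
        by (auto simp: path_edge_def doubleton_eq_iff)
      moreover have "g {u, v} = s e i" using gP[OF e(1,2)] e(3) by simp
      ultimately show ?thesis using good_P[OF e(1,2)] by auto
    qed
    then show "g {u, v} \<ge> 1 \<Longrightarrow> ?R u \<noteq> ?R v" "g {u, v} \<le> 1 \<Longrightarrow> ?B u \<noteq> ?B v"
      by blast+
  qed
qed

end

section \<open>From red multiplicities to an edge colouring\<close>

lemma lir_double_graph_le_2:
  fixes g :: "'a set \<Rightarrow> nat"
  assumes fin: "finite (sedges G)" and g2: "\<And>x. x \<in> sedges G \<Longrightarrow> g x \<le> 2"
    and red: "\<And>u v. \<lbrakk>{u, v} \<in> sedges G; g {u, v} \<ge> 1\<rbrakk> \<Longrightarrow>
      incident_sum (sedges G) g u \<noteq> incident_sum (sedges G) g v"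
    and blue: "\<And>u v. \<lbrakk>{u, v} \<in> sedges G; g {u, v} \<le> 1\<rbrakk> \<Longrightarrow>
      incident_sum (sedges G) (\<lambda>x. 2 - g x) u \<noteq> incident_sum (sedges G) (\<lambda>x. 2 - g x) v"
  shows "lir (double_graph G) \<le> 2"
proof -
  let ?M = "double_graph G"
  \<comment> \<open>Of the two copies of \<open>x\<close>, numbered 0 and 1, the first
    \<open>g x\<close> are red (colour 0) and the others blue (colour 1).\<close>
  define c :: "'a set \<times> nat \<Rightarrow> nat" where "c = (\<lambda>(x, j). if j < g x then 0 else 1)"
  have count_M: "count (medges ?M) x = (if x \<in> sedges G then 2 else 0)" for x
    using fin by (simp add: double_graph_def count_mset_set')
  have count0: "count (color_class ?M c 0) x = (if x \<in> sedges G then g x else 0)" for x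
  proof -
    have "{j. j < (2::nat) \<and> c (x, j) = 0} = {..<g x}" if "x \<in> sedges G"
      using g2[OF that] by (auto simp: c_def split: if_splits)
    then show ?thesis by (simp add: count_color_class count_M)
  qed
  have count1: "count (color_class ?M c 1) x = (if x \<in> sedges G then 2 - g x else 0)" for x
  proof -
    have "{j. j < (2::nat) \<and> c (x, j) = 1} = {g x..<2}"
      by (auto simp: c_def split: if_splits)
    then show ?thesis by (simp add: count_color_class count_M)
  qed
  have mdeg: "mdegree (induced_submultigraph A) v = incident_sum (sedges G) h v"
    if "\<And>x. count A x = (if x \<in> sedges G then h x else 0)" for A h v
  proof -
    have "set_mset A \<subseteq> sedges G" using that by (auto simp: set_mset_def split: if_splits)
    then have "(\<Sum>x | x \<in># A \<and> v \<in> x. count A x) = (\<Sum>x | x \<in> sedges G \<and> v \<in> x. count A x)"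
      by (intro sum.mono_neutral_left) (use fin in \<open>auto simp: count_eq_zero_iff\<close>)
    also have "\<dots> = (\<Sum>x | x \<in> sedges G \<and> v \<in> x. h x)"
      by (rule sum.cong) (auto simp: that)
    finally show ?thesis by (simp add: mdegree_def induced_submultigraph_def incident_sum_def)
  qed
  have "locally_irregular (induced_submultigraph (color_class ?M c i))" if "i \<in> {0, 1}" for i
    unfolding locally_irregular_def
  proof (intro allI impI)
    fix u v assume "{u, v} \<in># medges (induced_submultigraph (color_class ?M c i))"
    then have pos: "count (color_class ?M c i) {u, v} > 0" by (simp add: induced_submultigraph_def)
    show "mdegree (induced_submultigraph (color_class ?M c i)) u \<noteq>
      mdegree (induced_submultigraph (color_class ?M c i)) v"
    proof (cases "i = 0")
      case True
      have "{u, v} \<in> sedges G" "g {u, v} \<ge> 1" using pos unfolding True count0 by (auto split: if_splits)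
      from red[OF this] show ?thesis unfolding True mdeg[OF count0] .
    next
      case False
      with that have i: "i = 1" by simp
      have "{u, v} \<in> sedges G" "g {u, v} \<le> 1" using pos unfolding i count1 by (auto split: if_splits)
      from blue[OF this] show ?thesis unfolding i mdeg[OF count1] .
    qed
  qed
  moreover have sub: "c ` edge_elements ?M \<subseteq> {0, 1}" by (auto simp: c_def)
  ultimately have "locally_irregular_coloring ?M c" unfolding locally_irregular_coloring_def by blast
  moreover have "card (c ` edge_elements ?M) \<le> 2"
    using card_mono[OF _ sub] by simp
  ultimately have "lir ?M \<le> enat 2" unfolding lir_le_iff by blast
  then show ?thesis by (simp add: numeral_eq_enat)
qed

theorem theorem15:
  fixes H G :: "'a sgraph"
  assumes "simple_graph H" and "cubic H"
    and "edges_replaced_by_paths 5 H G"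
  shows "lir (double_graph G) \<le> 2"
proof -
  obtain F P where F: "F \<subseteq> sedges H"
    and P: "\<And>e. e \<in> F \<Longrightarrow> P e \<noteq> [] \<and> distinct (P e) \<and> {hd (P e), last (P e)} = e \<and>
      path_length (P e) \<ge> 5 \<and> internal_vertices (P e) \<inter> sverts H = {}"
    and disj: "disjoint_family_on (\<lambda>e. internal_vertices (P e)) F"
    and G: "sedges G = (sedges H - F) \<union> (\<Union>e\<in>F. path_edges (P e))"
    using assms(3) unfolding edges_replaced_by_paths_def by (elim exE conjE) (rule that, auto)
  have H: "finite (sverts H)" "\<And>e. e \<in> sedges H \<Longrightarrow> e \<subseteq> sverts H \<and> card e = 2"
    using assms(1) by (auto simp: simple_graph_def)
  have deg: "\<And>v. v \<in> sverts H \<Longrightarrow> card {e \<in> sedges H. v \<in> e} = 3"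
    using assms(2) by (auto simp: cubic_def sdegree_def)
  interpret subdivided_graph "sverts H" "sedges H" F P
    by unfold_locales (fact H F P disj)+
  have G_eq: "subdivided = sedges G" unfolding subdivided_def G ..
  obtain f :: "'a set \<Rightarrow> nat" where "\<And>e. f e \<le> 2"
    "\<And>u v. {u, v} \<in> sedges H \<Longrightarrow> incident_sum (sedges H) f u \<noteq> incident_sum (sedges H) f v"
    using cubic_weights_exist[OF H deg] by blast
  from subdivided_weights[OF deg this] obtain g :: "'a set \<Rightarrow> nat" where
    "\<And>x. x \<in> sedges G \<Longrightarrow> g x \<le> 2"
    "\<And>u v. \<lbrakk>{u, v} \<in> sedges G; g {u, v} \<ge> 1\<rbrakk> \<Longrightarrow>
      incident_sum (sedges G) g u \<noteq> incident_sum (sedges G) g v"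
    "\<And>u v. \<lbrakk>{u, v} \<in> sedges G; g {u, v} \<le> 1\<rbrakk> \<Longrightarrow>
      incident_sum (sedges G) (\<lambda>x. 2 - g x) u \<noteq> incident_sum (sedges G) (\<lambda>x. 2 - g x) v"
    unfolding G_eq by blast
  then show ?thesis
    using finite_sedges[OF simple_graph_edges_replaced_by_paths[OF assms(1,3)]]
    by (intro lir_double_graph_le_2)
qed

end
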